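(* Let $\mathcal H$ be a separable infinite-dimensional Hilbert lattice and let $C$ be a positive compact central operator on $\mathcal H$. Then $C$ is a self-commutator of a positive operator, i.e. there exists a positive operator $A$ on $\mathcal H$ such that $C=A^*A-AA^*$.
   Context: A Hilbert lattice is a (real) Banach lattice whose norm is induced by an inner product; $A^*$ denotes the Hilbert space adjoint of $A$. An operator on a vector lattice is positive if it maps the positive cone into itself (this is not positive semi-definiteness). An operator $C$ on a vector lattice $L$ is central if there exists a positive real number $\lambda$ such that $|Cx|\le\lambda|x|$ for every $x\in L$. *)

theory Defs
  imports "HOL-Analysis.Analysis" "HOL-Library.Lattice_Algebras"
begin

class vector_lattice = ordered_real_vector + lattice_ab_group_add_abs

class hilbert_lattice = vector_lattice + real_inner + complete_space +
  assumes norm_abs_mono: "\<bar>x\<bar> \<le> \<bar>y\<bar> \<Longrightarrow> norm x \<le> norm y"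

text \<open>The following three are predicates on maps; linearity (and boundedness) is
  always required separately by \<^const>\<open>bounded_linear\<close>.\<close>

definition positive_operator :: "('a::vector_lattice \<Rightarrow> 'a) \<Rightarrow> bool" where
  "positive_operator f \<longleftrightarrow> (\<forall>x\<ge>0. 0 \<le> f x)"

definition central_operator :: "('a::vector_lattice \<Rightarrow> 'a) \<Rightarrow> bool" where
  "central_operator f \<longleftrightarrow> (\<exists>l::real. l > 0 \<and> (\<forall>x. \<bar>f x\<bar> \<le> l *\<^sub>R \<bar>x\<bar>))"

definition compact_operator :: "('a::real_normed_vector \<Rightarrow> 'b::real_normed_vector) \<Rightarrow> bool" where
  "compact_operator f \<longleftrightarrow> (\<forall>S. bounded S \<longrightarrow> compact (closure (f ` S)))"

end

theory Submission
  imports Defs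
begin

text \<open>A positive central operator acts like multiplication by a bounded nonnegative function, and
  compactness confines the support of that function to atoms: there is an infinite sequence of pairwise
  disjoint positive unit vectors \<open>f n\<close> with \<open>C (f n) = c n f n\<close>, where \<open>c n
  \<ge> 0\<close> tends to zero and \<open>C\<close> vanishes on the orthogonal complement
  (\<open>positive_diagonalisation\<close>). The operator \<open>A\<close> is then a weighted shift \<open>f n
  \<mapsto> w n f (\<sigma> n)\<close> along these vectors, zero on the complement. Its self-commutator is
  diagonal with entries \<open>(w m)\<^sup>2 - (w n)\<^sup>2\<close> for \<open>m = \<sigma> n\<close> and
  \<open>(w m)\<^sup>2\<close> for \<open>m\<close> outside the range of \<open>\<sigma>\<close>, so the
  weights are forced to be partial sums of \<open>c\<close> along the orbits of \<open>\<sigma>\<close>. They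
  stay bounded, even if \<open>c\<close> is not summable, when \<open>\<sigma>\<close> jumps far enough ahead
  (\<open>shift_weights\<close>): this amounts to splitting the index set into orbits with uniformly bounded
  sums of \<open>c\<close>.

  For the diagonalisation, the monotone norm makes disjointness of positive vectors the same as orthogonality.
  The form \<open>C x \<bullet> y\<close> is therefore positive and vanishes on disjoint pairs, and every such
  form is symmetric (\<open>orthosymmetric_imp_symmetric\<close>). So \<open>C\<close> is self-adjoint, and
  the spectral argument for compact operators applies (\<open>compact_self_adjoint_eigenvector\<close>). It
  commutes with the absolute value, so its eigenspaces are sublattices. A sublattice that contains no infinite
  disjoint family has a finite basis of disjoint positive vectors (\<open>finite_positive_basis\<close>). This
  provides positive bases of the eigenspaces for positive eigenvalues, and it also shows, when
  \<open>C\<close> has finite rank, that the kernel contains an infinite disjoint family, which the shift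
  needs as room to move.\<close>

section \<open>Order and inner product in a Hilbert lattice\<close>

lemma inf_pprt_nprt:
  fixes y :: "'a::lattice_ab_group_add"
  shows "inf (pprt y) (- nprt y) = 0"
proof -
  have "- nprt y = pprt y - y"
    using prts[of y] by (simp add: algebra_simps)
  then have "inf (pprt y) (- nprt y) = pprt y + inf 0 (- y)"
    using add_inf_distrib_left[of "pprt y" 0 "- y"] by simp
  also have "inf 0 (- y) = - pprt y"
    by (simp add: pprt_def neg_sup_eq_inf inf_commute)
  finally show ?thesis by simp
qed

lemma abs_diff_disjoint:
  fixes a b :: "'a::lattice_ab_group_add_abs"
  assumes "inf a b = 0"
  shows "\<bar>a - b\<bar> = a + b"
proof -
  have "pprt (a - b) = a"
  proof -
    have "pprt (a - b) = a + sup (- b) (- a)"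
      by (simp add: pprt_def add_sup_distrib_left)
    also have "sup (- b) (- a) = - inf a b"
      by (simp add: neg_inf_eq_sup sup_commute)
    finally show ?thesis by (simp add: assms)
  qed
  then show ?thesis
    using prts[of "a - b"] by (simp add: abs_prts algebra_simps)
qed

lemma abs_scaleR_nonneg:
  fixes x :: "'a::vector_lattice"
  assumes "0 \<le> c"
  shows "\<bar>c *\<^sub>R x\<bar> = c *\<^sub>R \<bar>x\<bar>"
proof (cases "c = 0")
  case False
  have le: "\<bar>d *\<^sub>R z\<bar> \<le> d *\<^sub>R \<bar>z\<bar>" if "0 \<le> d" for d and z :: 'a
  proof (rule abs_leI)
    show "d *\<^sub>R z \<le> d *\<^sub>R \<bar>z\<bar>" by (rule scaleR_left_mono[OF abs_ge_self that])
    have "d *\<^sub>R (- z) \<le> d *\<^sub>R \<bar>z\<bar>" by (rule scaleR_left_mono[OF abs_ge_minus_self that])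
    then show "- (d *\<^sub>R z) \<le> d *\<^sub>R \<bar>z\<bar>" by simp
  qed
  have "c *\<^sub>R \<bar>(1 / c) *\<^sub>R (c *\<^sub>R x)\<bar> \<le> c *\<^sub>R ((1 / c) *\<^sub>R \<bar>c *\<^sub>R x\<bar>)"
    using assms by (intro scaleR_left_mono le) auto
  then show ?thesis using le[OF assms, of x] False by (simp add: antisym)
qed simp

lemma norm_abs_hilbert [simp]: "norm \<bar>x\<bar> = norm (x :: 'a::hilbert_lattice)"
  by (rule antisym) (simp_all add: norm_abs_mono)

text \<open>The monotone norm recognises the angle between positive vectors: since
  \<open>\<bar>x - y\<bar> \<le> x + y\<close>, the polarisation identity gives a nonnegative inner product.\<close>

lemma inner_nonneg:
  fixes x y :: "'a::hilbert_lattice"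
  assumes "0 \<le> x" "0 \<le> y"
  shows "0 \<le> x \<bullet> y"
proof -
  have "\<bar>x - y\<bar> \<le> \<bar>x + y\<bar>"
    using assms abs_triangle_ineq4[of x y] by simp
  then have "norm (x - y) \<le> norm (x + y)" by (rule norm_abs_mono)
  then have "(norm (x - y))\<^sup>2 \<le> (norm (x + y))\<^sup>2" by (simp add: power_mono)
  then show ?thesis
    by (simp add: power2_norm_eq_inner algebra_simps inner_commute)
qed

lemma inner_mono:
  fixes x y :: "'a::hilbert_lattice"
  assumes "0 \<le> x" "x \<le> x'" "0 \<le> y" "y \<le> y'"
  shows "x \<bullet> y \<le> x' \<bullet> y'"
proof -
  have "0 \<le> (x' - x) \<bullet> y'" "0 \<le> x \<bullet> (y' - y)"
    using assms by (auto intro!: inner_nonneg intro: order_trans)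
  then show ?thesis by (simp add: inner_diff_left inner_diff_right)
qed

text \<open>For positive vectors disjointness and orthogonality coincide. In one direction
  \<open>\<bar>x - y\<bar> = x + y\<close> makes \<open>x - y\<close> and \<open>x + y\<close> equally long; in the other,
  \<open>inf x y\<close> lies below both vectors, so its square is at most \<open>x \<bullet> y\<close>.\<close>

lemma disjoint_imp_orthogonal:
  fixes x y :: "'a::hilbert_lattice"
  assumes "inf x y = 0"
  shows "x \<bullet> y = 0"
proof -
  have "norm (x - y) = norm (x + y)"
    by (metis abs_diff_disjoint[OF assms] norm_abs_hilbert)
  then have "(norm (x - y))\<^sup>2 = (norm (x + y))\<^sup>2" by simp
  then show ?thesis
    by (simp add: power2_norm_eq_inner algebra_simps inner_commute)
qed

lemma orthogonal_imp_disjoint: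
  fixes x y :: "'a::hilbert_lattice"
  assumes "0 \<le> x" "0 \<le> y" "x \<bullet> y = 0"
  shows "inf x y = 0"
proof -
  have "inf x y \<bullet> inf x y \<le> x \<bullet> y"
    using assms by (intro inner_mono) auto
  then show ?thesis
    using assms(3) by (metis antisym inner_eq_zero_iff inner_ge_zero)
qed

lemma pprt_nprt_orthogonal: "pprt x \<bullet> nprt x = 0" for x :: "'a::hilbert_lattice"
  using disjoint_imp_orthogonal[OF inf_pprt_nprt[of x]] by simp

text \<open>The positive cone is self-dual: test against the negative part of \<open>x\<close>.\<close>

lemma nonneg_if_inner_nonneg:
  fixes x :: "'a::hilbert_lattice"
  assumes "\<And>y. 0 \<le> y \<Longrightarrow> 0 \<le> x \<bullet> y"
  shows "0 \<le> x"
proof -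
  have "0 \<le> x \<bullet> (- nprt x)" by (rule assms) simp
  also have "x \<bullet> (- nprt x) = - (nprt x \<bullet> nprt x)"
    by (subst prts[of x]) (simp add: inner_add_left pprt_nprt_orthogonal)
  finally have "nprt x \<bullet> nprt x \<le> 0" by simp
  then have "nprt x = 0"
    by (metis antisym inner_eq_zero_iff inner_ge_zero)
  then show ?thesis by (simp add: zero_le_iff_zero_nprt)
qed

section \<open>Orthosymmetric forms and central operators\<close>

text \<open>A positive bilinear form that vanishes on disjoint pairs behaves like an integral
  of the pointwise product. To compare \<open>B x e\<close> with \<open>B e x\<close> for \<open>0 \<le> x \<le> e\<close>, slice
  \<open>n x\<close> into layers of height \<open>e\<close>, with \<open>g i\<close> the part between \<open>i e\<close> and \<open>(i + 1) e\<close>.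
  Where \<open>g (i + 1)\<close> is nonzero the layer \<open>g i\<close> is full, so \<open>g (i + 1)\<close> and \<open>e - g i\<close>
  are disjoint and \<open>B (g (i + 1)) e = B (g (i + 1)) (g i) \<le> B e (g i)\<close>. Summing over
  \<open>i\<close> leaves only the bottom layer, which costs at most \<open>B e e\<close>.\<close>

lemma orthosymmetric_layer_bound:
  fixes B :: "'a::vector_lattice \<Rightarrow> 'a \<Rightarrow> real"
  assumes bil: "bilinear B"
    and pos: "\<And>x y. 0 \<le> x \<Longrightarrow> 0 \<le> y \<Longrightarrow> 0 \<le> B x y"
    and orth: "\<And>x y. inf x y = 0 \<Longrightarrow> B x y = 0"
    and x: "0 \<le> x" "x \<le> e"
  shows "real n * B x e \<le> real n * B e x + B e e"
proof (cases n)
  case 0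
  then show ?thesis using pos[of e e] x by (auto intro: order_trans)
next
  case (Suc m)
  have e: "0 \<le> e" using x by (rule order_trans)
  have B_mono: "B u v \<le> B u' v'" if "0 \<le> u" "u \<le> u'" "0 \<le> v" "v \<le> v'" for u u' v v'
  proof -
    have "0 \<le> B (u' - u) v'" "0 \<le> B u (v' - v)"
      using that by (auto intro!: pos intro: order_trans)
    then show ?thesis by (simp add: bilinear_lsub[OF bil] bilinear_rsub[OF bil])
  qed
  define a where "a i = pprt (real n *\<^sub>R x - real i *\<^sub>R e)" for i
  define g where "g i = a i - a (Suc i)" for i
  have g_nonneg: "0 \<le> g i" for i
  proof -
    have "a (Suc i) \<le> a i"
      unfolding a_def using e by (intro pprt_mono) (simp add: algebra_simps)
    then show ?thesis by (simp add: g_def)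
  qed
  have g_le: "g i \<le> e" for i
  proof -
    define y where "y = real n *\<^sub>R x - real (Suc i) *\<^sub>R e"
    have "y \<le> pprt y" by (simp add: pprt_def)
    then have "pprt (y + e) \<le> pprt y + e"
      unfolding pprt_def[of "y + e"] using e by (auto intro: add_nonneg_nonneg)
    moreover have "a i = pprt (y + e)" "a (Suc i) = pprt y"
      by (simp_all add: a_def y_def algebra_simps)
    ultimately show ?thesis by (simp add: g_def algebra_simps)
  qed
  have step: "B (g (Suc i)) e \<le> B e (g i)" for i
  proof -
    define y where "y = real n *\<^sub>R x - real (Suc i) *\<^sub>R e"
    have ai: "a i = pprt (y + e)" "a (Suc i) = pprt y"
      by (simp_all add: a_def y_def algebra_simps)
    have "0 \<le> a (Suc (Suc i))" by (simp add: a_def)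
    then have 1: "g (Suc i) \<le> pprt y" by (simp add: g_def ai)
    have "y + e \<le> pprt (y + e)" by (simp add: pprt_def)
    then have 2: "e - g i \<le> - nprt y"
      using prts[of y] by (simp add: g_def ai algebra_simps)
    have "B (g (Suc i)) (e - g i) \<le> B (pprt y) (- nprt y)"
      using 1 2 g_nonneg g_le by (intro B_mono) auto
    then have "B (g (Suc i)) (e - g i) \<le> 0"
      by (simp add: orth inf_pprt_nprt)
    then have "B (g (Suc i)) e \<le> B (g (Suc i)) (g i)"
      by (simp add: bilinear_rsub[OF bil])
    also have "\<dots> \<le> B e (g i)"
      using g_nonneg g_le by (intro B_mono) auto
    finally show ?thesis .
  qed
  have a_n: "a n = 0"
    unfolding a_def using x by (intro pprt_eq_0) (simp add: scaleR_left_mono)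
  have a_0: "a 0 = real n *\<^sub>R x"
    unfolding a_def using x by (simp add: scaleR_nonneg_nonneg)
  have total: "(\<Sum>i<n. g i) = real n *\<^sub>R x"
    unfolding g_def by (simp add: sum_lessThan_telescope' a_n a_0)
  have left: "real n * B x e = (\<Sum>i<n. B (g i) e)"
  proof -
    have "real n * B x e = B (real n *\<^sub>R x) e" by (simp add: bilinear_lmul[OF bil])
    also have "\<dots> = (\<Sum>i<n. B (g i) e)"
      using bil unfolding total[symmetric] bilinear_def
      by (metis linear_sum[of "\<lambda>u. B u e"])
    finally show ?thesis .
  qed
  have right: "real n * B e x = (\<Sum>i<n. B e (g i))"
  proof -
    have "real n * B e x = B e (real n *\<^sub>R x)" by (simp add: bilinear_rmul[OF bil])
    also have "\<dots> = (\<Sum>i<n. B e (g i))"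
      using bil unfolding total[symmetric] bilinear_def
      by (metis linear_sum[of "\<lambda>u. B e u"])
    finally show ?thesis .
  qed
  have "(\<Sum>i<n. B (g i) e) = B (g 0) e + (\<Sum>i<m. B (g (Suc i)) e)"
    unfolding Suc by (rule sum.lessThan_Suc_shift)
  also have "\<dots> \<le> B e e + (\<Sum>i<m. B e (g i))"
    using e g_nonneg g_le by (intro add_mono sum_mono step B_mono) auto
  also have "\<dots> \<le> B e e + (\<Sum>i<n. B e (g i))"
    using pos[OF e g_nonneg] by (simp add: Suc)
  finally show ?thesis by (simp add: left right)
qed

text \<open>Letting \<open>n\<close> tend to infinity gives \<open>B x e = B e x\<close> for \<open>0 \<le> x \<le> e\<close>; positive
  \<open>x\<close> and \<open>y\<close> are then compared through \<open>e = x + y\<close>, and general vectors through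
  their positive and negative parts.\<close>

lemma orthosymmetric_imp_symmetric:
  fixes B :: "'a::vector_lattice \<Rightarrow> 'a \<Rightarrow> real"
  assumes bil: "bilinear B"
    and pos: "\<And>x y. 0 \<le> x \<Longrightarrow> 0 \<le> y \<Longrightarrow> 0 \<le> B x y"
    and orth: "\<And>x y. inf x y = 0 \<Longrightarrow> B x y = 0"
  shows "B x y = B y x"
proof -
  have bil': "bilinear (\<lambda>x y. B y x)" using bil by (auto simp: bilinear_def)
  have le_by_limit: "s \<le> t" if "\<And>n. real n * s \<le> real n * t + d" for s t d :: real
  proof (rule ccontr)
    assume "\<not> s \<le> t"
    then obtain n where "d < real n * (s - t)"
      using reals_Archimedean3[of "s - t"] by auto
    then show False using that[of n] by (simp add: algebra_simps)
  qed
  have below: "B x e = B e x" if "0 \<le> x" "x \<le> e" for x e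
  proof (rule antisym)
    show "B x e \<le> B e x"
      by (rule le_by_limit, rule orthosymmetric_layer_bound[OF bil pos orth that])
    show "B e x \<le> B x e"
      by (rule le_by_limit, rule orthosymmetric_layer_bound[OF bil' pos _ that])
        (auto simp: inf_commute intro: orth)
  qed
  have cone: "B x y = B y x" if "0 \<le> x" "0 \<le> y" for x y
    using below[of x "x + y"] that
    by (simp add: bilinear_ladd[OF bil] bilinear_radd[OF bil])
  have half: "B x y = B y x" if "0 \<le> y" for x y
  proof -
    have "B (pprt x) y = B y (pprt x)" "B (- nprt x) y = B y (- nprt x)"
      using that by (auto intro: cone)
    then show ?thesis
      by (subst (1 2) prts[of x])
        (simp add: bilinear_ladd[OF bil] bilinear_radd[OF bil]
          bilinear_lneg[OF bil] bilinear_rneg[OF bil])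
  qed
  have "B x (pprt y) = B (pprt y) x" "B x (- nprt y) = B (- nprt y) x"
    by (auto intro: half)
  then show ?thesis
    by (subst (1 2) prts[of y])
      (simp add: bilinear_ladd[OF bil] bilinear_radd[OF bil]
        bilinear_lneg[OF bil] bilinear_rneg[OF bil])
qed

lemma positive_central_bound:
  fixes C :: "'a::hilbert_lattice \<Rightarrow> 'a"
  assumes "positive_operator C" "central_operator C"
  obtains l where "0 < l" "\<And>x. 0 \<le> x \<Longrightarrow> 0 \<le> C x" "\<And>x. 0 \<le> x \<Longrightarrow> C x \<le> l *\<^sub>R x"
proof -
  obtain l where l: "l > 0" "\<And>x. \<bar>C x\<bar> \<le> l *\<^sub>R \<bar>x\<bar>"
    using assms(2) unfolding central_operator_def by blast
  have "0 \<le> C x" "C x \<le> l *\<^sub>R x" if "0 \<le> x" for x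
    using assms(1) that l(2)[of x] by (auto simp: positive_operator_def)
  then show thesis using l(1) that by blast
qed

text \<open>Since \<open>0 \<le> C x \<le> l x\<close> and \<open>0 \<le> C y \<le> l y\<close>, both inner products lie between zero and a
  multiple of \<open>x \<bullet> y\<close>.\<close>

lemma positive_central_orthogonal:
  fixes C :: "'a::hilbert_lattice \<Rightarrow> 'a"
  assumes "positive_operator C" "central_operator C"
    and "0 \<le> x" "0 \<le> y" "x \<bullet> y = 0"
  shows "C x \<bullet> y = 0" "C x \<bullet> C y = 0"
proof -
  obtain l where l: "0 < l" "\<And>x. 0 \<le> x \<Longrightarrow> 0 \<le> C x" "\<And>x. 0 \<le> x \<Longrightarrow> C x \<le> l *\<^sub>R x"
    using positive_central_bound[OF assms(1,2)] by metis
  have "C x \<bullet> y \<le> (l *\<^sub>R x) \<bullet> y" "C x \<bullet> C y \<le> (l *\<^sub>R x) \<bullet> (l *\<^sub>R y)"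
    by (rule inner_mono; use l assms in \<open>simp add: scaleR_nonneg_nonneg\<close>)+
  then have "C x \<bullet> y \<le> 0" "C x \<bullet> C y \<le> 0"
    using assms(5) by simp_all
  then show "C x \<bullet> y = 0" "C x \<bullet> C y = 0"
    using inner_nonneg[OF l(2)[OF assms(3)] assms(4)]
      inner_nonneg[OF l(2)[OF assms(3)] l(2)[OF assms(4)]]
    by linarith+
qed

text \<open>By the previous lemma the form \<open>C x \<bullet> y\<close> is orthosymmetric.\<close>

lemma positive_central_self_adjoint:
  fixes C :: "'a::hilbert_lattice \<Rightarrow> 'a"
  assumes lin: "bounded_linear C" and "positive_operator C" "central_operator C"
  shows "C x \<bullet> y = x \<bullet> C y"
proof -
  interpret bounded_linear C by fact
  have "C x \<bullet> y = C y \<bullet> x"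
  proof (rule orthosymmetric_imp_symmetric[where B = "\<lambda>x y. C x \<bullet> y"])
    show "bilinear (\<lambda>x y. C x \<bullet> y)"
      by (auto simp: bilinear_def intro!: linearI simp: add scaleR inner_add_left inner_add_right)
    show "0 \<le> C x \<bullet> y" if "0 \<le> x" "0 \<le> y" for x y
      using that assms by (auto simp: positive_operator_def intro: inner_nonneg)
    show "C x \<bullet> y = 0" if "inf x y = 0" for x y
      using that positive_central_orthogonal(1)[OF assms(2,3)] disjoint_imp_orthogonal[OF that]
      by (metis inf.cobounded1 inf.cobounded2)
  qed
  then show ?thesis by (simp add: inner_commute)
qed

text \<open>The images of the positive and the negative part of \<open>x\<close> stay disjoint. This is what makes
  eigenspaces sublattices.\<close>

lemma positive_central_abs:
  fixes C :: "'a::hilbert_lattice \<Rightarrow> 'a"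
  assumes lin: "bounded_linear C" and pos: "positive_operator C" and "central_operator C"
  shows "C \<bar>x\<bar> = \<bar>C x\<bar>"
proof -
  interpret bounded_linear C by fact
  have "C (pprt x) \<bullet> C (- nprt x) = 0"
    using pprt_nprt_orthogonal[of x]
    by (intro positive_central_orthogonal[OF assms(2,3)]) auto
  then have "inf (C (pprt x)) (C (- nprt x)) = 0"
    using pos by (intro orthogonal_imp_disjoint) (auto simp: positive_operator_def)
  then have "\<bar>C (pprt x) - C (- nprt x)\<bar> = C (pprt x) + C (- nprt x)"
    by (rule abs_diff_disjoint)
  then show ?thesis
    using prts[of x] by (simp add: abs_prts[of x] flip: add diff)
qed

lemma positive_central_semidefinite:
  fixes C :: "'a::hilbert_lattice \<Rightarrow> 'a"
  assumes lin: "bounded_linear C" and pos: "positive_operator C" and cent: "central_operator C"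
  shows "0 \<le> C x \<bullet> x"
proof -
  interpret bounded_linear C by fact
  let ?p = "pprt x" and ?n = "- nprt x"
  have z: "C ?p \<bullet> ?n = 0" "C ?n \<bullet> ?p = 0"
    using pprt_nprt_orthogonal[of x]
    by (rule_tac positive_central_orthogonal(1)[OF pos cent]; simp add: inner_commute)+
  have "0 \<le> C ?p \<bullet> ?p" "0 \<le> C ?n \<bullet> ?n"
    by (rule inner_nonneg; use pos in \<open>simp add: positive_operator_def\<close>)+
  moreover have x: "x = ?p - ?n" using prts[of x] by simp
  have "C x \<bullet> x = (C ?p - C ?n) \<bullet> (?p - ?n)"
    by (subst (1 2) x) (simp only: diff)
  then have "C x \<bullet> x = C ?p \<bullet> ?p + C ?n \<bullet> ?n"
    using z by (simp only: inner_diff_left inner_diff_right)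
  ultimately show ?thesis by simp
qed

section \<open>Sublattices with and without infinite disjoint sequences\<close>

definition vector_sublattice :: "'a::vector_lattice set \<Rightarrow> bool" where
  "vector_sublattice E \<longleftrightarrow> subspace E \<and> (\<forall>x\<in>E. \<bar>x\<bar> \<in> E)"

lemma pprt_eq_half_abs: "pprt x = (1/2) *\<^sub>R (x + \<bar>x\<bar>)" for x :: "'a::vector_lattice"
proof -
  have "x + \<bar>x\<bar> = pprt x + pprt x"
    by (subst (1) prts[of x]) (simp add: abs_prts)
  then show ?thesis by (simp flip: scaleR_2)
qed

lemma vector_sublattice_pprt:
  assumes "vector_sublattice E" "x \<in> E"
  shows "pprt x \<in> E"
  using assms unfolding vector_sublattice_def pprt_eq_half_abs
  by (auto intro: subspace_scale subspace_add)

lemma vector_sublattice_nprt: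
  assumes "vector_sublattice E" "x \<in> E"
  shows "nprt x \<in> E"
proof -
  have "nprt x = x - pprt x" using prts[of x] by (simp add: algebra_simps)
  then show ?thesis
    using assms vector_sublattice_pprt[OF assms]
    by (auto simp: vector_sublattice_def intro: subspace_diff)
qed

lemma vector_sublattice_inf:
  assumes "vector_sublattice E" "x \<in> E" "y \<in> E"
  shows "inf x y \<in> E"
proof -
  have "inf x y = x + inf 0 (y - x)"
    using add_inf_distrib_left[of x 0 "y - x"] by simp
  also have "\<dots> = x + nprt (y - x)" by (simp add: nprt_def inf_commute)
  finally show ?thesis
    using assms vector_sublattice_nprt[OF assms(1), of "y - x"]
    by (auto simp: vector_sublattice_def intro: subspace_add subspace_diff)
qed

definition positive_orthonormal :: "'a::hilbert_lattice set \<Rightarrow> bool" where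
  "positive_orthonormal G \<longleftrightarrow> (\<forall>f\<in>G. 0 \<le> f \<and> norm f = 1) \<and> pairwise orthogonal G"

text \<open>An atom in the sense of \<open>E\<close>; the ambient lattice may split it further.\<close>

definition atom_of :: "'a::hilbert_lattice set \<Rightarrow> 'a \<Rightarrow> bool" where
  "atom_of E f \<longleftrightarrow> f \<in> E \<and> 0 \<le> f \<and> f \<noteq> 0 \<and> (\<forall>y\<in>E. 0 \<le> y \<and> y \<le> f \<longrightarrow> (\<exists>t. y = t *\<^sub>R f))"

text \<open>If \<open>0 \<le> y \<le> z\<close> and \<open>y\<close> is not a multiple of \<open>z\<close>, remove from \<open>y\<close> its component
  along \<open>z\<close>. The rest \<open>d\<close> is orthogonal to \<open>z\<close> although \<open>\<bar>d\<bar>\<close> lies below a multiple of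
  \<open>z\<close>, so it takes both signs, and its positive and negative parts yield the disjoint pieces.\<close>

lemma split_non_atom:
  fixes z :: "'a::hilbert_lattice"
  assumes E: "vector_sublattice E" and z: "z \<in> E" "0 \<le> z" "z \<noteq> 0" and "\<not> atom_of E z"
  obtains u v where "u \<in> E" "v \<in> E" "0 \<le> u" "u \<le> z" "0 \<le> v" "v \<le> z" "u \<noteq> 0" "v \<noteq> 0" "u \<bullet> v = 0"
proof -
  obtain y where y: "y \<in> E" "0 \<le> y" "y \<le> z" "\<And>t. y \<noteq> t *\<^sub>R z"
    using assms unfolding atom_of_def by auto
  have sub: "subspace E" using E by (simp add: vector_sublattice_def)
  define t where "t = (y \<bullet> z) / (z \<bullet> z)"
  define d where "d = y - t *\<^sub>R z"
  have t: "0 \<le> t" unfolding t_def using y z by (simp add: inner_nonneg)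
  have dz: "d \<bullet> z = 0" using z by (simp add: d_def t_def inner_diff_left)
  have d: "d \<noteq> 0" using y(4) by (simp add: d_def)
  have dE: "d \<in> E" unfolding d_def using sub y z by (intro subspace_diff subspace_scale)
  have le: "\<bar>d\<bar> \<le> (1 + t) *\<^sub>R z"
  proof -
    have "\<bar>d\<bar> \<le> \<bar>y\<bar> + \<bar>t *\<^sub>R z\<bar>" unfolding d_def by (rule abs_triangle_ineq4)
    also have "\<dots> \<le> z + t *\<^sub>R z" using y t z by (simp add: scaleR_nonneg_nonneg)
    finally show ?thesis by (simp add: scaleR_left_distrib)
  qed
  have one_sign: "e = 0" if "0 \<le> e" "e \<le> \<bar>d\<bar>" "e \<bullet> z = 0" for e
  proof -
    have "e \<bullet> e \<le> e \<bullet> ((1 + t) *\<^sub>R z)"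
      using that le by (intro inner_mono) auto
    then have "e \<bullet> e \<le> 0" using that by simp
    then show ?thesis by (metis antisym inner_eq_zero_iff inner_ge_zero)
  qed
  \<comment> \<open>Scaling by \<open>s\<close> brings both parts of \<open>d\<close> below \<open>z\<close>.\<close>
  define s where "s = inverse (1 + t)"
  have s: "0 < s" using t by (simp add: s_def)
  have s_le: "s *\<^sub>R e \<le> z" if "e \<le> \<bar>d\<bar>" for e
  proof -
    have "s *\<^sub>R e \<le> s *\<^sub>R ((1 + t) *\<^sub>R z)"
      using that le s by (intro scaleR_left_mono) auto
    then show ?thesis using t by (simp add: s_def)
  qed
  have le_abs: "pprt d \<le> \<bar>d\<bar>" "- nprt d \<le> \<bar>d\<bar>" by (simp_all add: abs_prts)
  have "pprt d \<bullet> z = - nprt d \<bullet> z"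
    using dz by (subst (asm) prts[of d]) (simp add: inner_add_left)
  then have "pprt d = 0 \<longleftrightarrow> - nprt d = 0"
    using one_sign[of "pprt d"] one_sign[of "- nprt d"] le_abs by auto
  then have nz: "pprt d \<noteq> 0" "- nprt d \<noteq> 0"
    using d prts[of d] by auto
  show thesis
  proof (rule that)
    show "s *\<^sub>R pprt d \<in> E" "s *\<^sub>R (- nprt d) \<in> E"
      using vector_sublattice_pprt[OF E dE] vector_sublattice_nprt[OF E dE] sub
      by (auto intro!: subspace_scale subspace_neg)
    show "s *\<^sub>R pprt d \<le> z" "s *\<^sub>R (- nprt d) \<le> z"
      using s_le le_abs by blast+
    show "0 \<le> s *\<^sub>R pprt d" "0 \<le> s *\<^sub>R (- nprt d)"
      using s by (simp_all only: scaleR_nonneg_nonneg zero_le_pprt neg_0_le_iff_le nprt_le_zero less_imp_le)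
    show "s *\<^sub>R pprt d \<noteq> 0" "s *\<^sub>R (- nprt d) \<noteq> 0"
      using s nz by auto
    show "s *\<^sub>R pprt d \<bullet> s *\<^sub>R (- nprt d) = 0"
      using pprt_nprt_orthogonal[of d] by simp
  qed
qed

text \<open>Below an element without atoms one can split forever: keep one piece \<open>v n\<close> and split
  the other, \<open>u n\<close>.\<close>

lemma atom_or_disjoint_sequence:
  fixes x :: "'a::hilbert_lattice"
  assumes E: "vector_sublattice E" and x: "x \<in> E" "0 \<le> x" "x \<noteq> 0"
  shows "(\<exists>f. atom_of E f \<and> f \<le> x) \<or> (\<exists>G\<subseteq>E. positive_orthonormal G \<and> infinite G)"
proof (rule disjCI)
  assume "\<not> (\<exists>G\<subseteq>E. positive_orthonormal G \<and> infinite G)"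
  then have fin: "finite G" if "G \<subseteq> E" "positive_orthonormal G" for G
    using that by blast
  have sub: "subspace E" using E by (simp add: vector_sublattice_def)
  show "\<exists>f. atom_of E f \<and> f \<le> x"
  proof (rule ccontr)
    assume no: "\<not> (\<exists>f. atom_of E f \<and> f \<le> x)"
    define P where "P p \<longleftrightarrow> fst p \<in> E \<and> snd p \<in> E \<and> 0 \<le> fst p \<and> fst p \<le> x \<and> fst p \<noteq> 0
        \<and> 0 \<le> snd p \<and> snd p \<noteq> 0 \<and> fst p \<bullet> snd p = 0" for p :: "'a \<times> 'a"
    define Q where "Q p q \<longleftrightarrow> fst q \<le> fst p \<and> snd q \<le> fst p" for p q :: "'a \<times> 'a"
    have split: "\<exists>q. P q \<and> fst q \<le> z \<and> snd q \<le> z" if z: "z \<in> E" "0 \<le> z" "z \<noteq> 0" "z \<le> x" for z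
    proof -
      have "\<not> atom_of E z" using no z by blast
      then obtain u v where "u \<in> E" "v \<in> E" "0 \<le> u" "u \<le> z" "0 \<le> v" "v \<le> z" "u \<noteq> 0" "v \<noteq> 0" "u \<bullet> v = 0"
        using split_non_atom[OF E z(1-3)] by metis
      then have "P (u, v) \<and> fst (u, v) \<le> z \<and> snd (u, v) \<le> z"
        using z(4) by (auto simp: P_def intro: order_trans)
      then show ?thesis by blast
    qed
    have "\<exists>h. \<forall>n. P (h n) \<and> Q (h n) (h (Suc n))"
    proof (rule dependent_nat_choice)
      show "\<exists>p. P p" using split[OF x] by blast
      show "\<exists>q. P q \<and> Q p q" if "P p" for p and n :: nat
        using split[of "fst p"] that unfolding P_def Q_def by blast
    qed
    then obtain h where h: "\<And>n. P (h n)" "\<And>n. Q (h n) (h (Suc n))" by blast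
    define u v where "u n = fst (h n)" and "v n = snd (h n)" for n
    have uv: "u n \<in> E" "v n \<in> E" "0 \<le> u n" "0 \<le> v n" "v n \<noteq> 0" "u n \<bullet> v n = 0" for n
      using h(1)[of n] by (auto simp: P_def u_def v_def)
    have step: "u (Suc n) \<le> u n" "v (Suc n) \<le> u n" for n
      using h(2)[of n] by (auto simp: Q_def u_def v_def)
    have "decseq u" using step by (intro decseq_SucI)
    have less: "v m \<bullet> v n = 0" if "n < m" for m n
    proof -
      obtain k where k: "m = Suc k" "n \<le> k" using \<open>n < m\<close> by (cases m) auto
      have "v m \<le> u n"
        using step(2)[of k] decseqD[OF \<open>decseq u\<close> k(2)] k by (auto intro: order_trans)
      then have "v m \<bullet> v n \<le> u n \<bullet> v n" using uv by (intro inner_mono) auto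
      then show ?thesis using uv(6)[of n] inner_nonneg[OF uv(4)[of m] uv(4)[of n]] by linarith
    qed
    have orth: "v m \<bullet> v n = 0" if "m \<noteq> n" for m n
      using less[of m n] less[of n m] that by (auto simp: inner_commute neq_iff)
    define w where "w n = (1 / norm (v n)) *\<^sub>R v n" for n
    have w: "norm (w n) = 1" "0 \<le> w n" "w n \<in> E" for n
      using uv[of n] sub by (auto simp: w_def scaleR_nonneg_nonneg intro: subspace_scale)
    have w_orth: "w m \<bullet> w n = 0" if "m \<noteq> n" for m n
      using orth[OF that] by (simp add: w_def)
    have "inj w"
    proof (rule injI, rule ccontr)
      fix m n assume "w m = w n" "m \<noteq> n"
      then have "w n \<bullet> w n = 0" using w_orth[of m n] by simp
      then show False using w(1)[of n] by simp
    qed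
    moreover have "positive_orthonormal (range w)"
      using w w_orth by (auto simp: positive_orthonormal_def pairwise_def orthogonal_def) metis
    ultimately show False
      using fin[of "range w"] w(3) finite_imageD[of w UNIV] by auto
  qed
qed

text \<open>A sublattice without infinite disjoint families is spanned by its finitely many unit
  atoms. Distinct unit atoms \<open>f\<close>, \<open>g\<close> are disjoint, because \<open>inf f g\<close> is a multiple of each. If
  \<open>x\<close> in \<open>E\<close> is orthogonal to the atom \<open>f\<close>, then so is \<open>\<bar>x\<bar>\<close>: the infima of
  \<open>f\<close> with the positive and with the negative part of \<open>x\<close> are orthogonal multiples of \<open>f\<close>, so one of
  them is zero and that part is orthogonal to \<open>f\<close>; then so is the other part. Hence an
  atom below \<open>\<bar>x\<bar>\<close> would be orthogonal to itself.\<close>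

lemma finite_positive_basis:
  fixes E :: "'a::hilbert_lattice set"
  assumes E: "vector_sublattice E"
    and fin: "\<And>G. G \<subseteq> E \<Longrightarrow> positive_orthonormal G \<Longrightarrow> finite G"
  obtains G where "G \<subseteq> E" "finite G" "positive_orthonormal G" "E \<subseteq> span G"
proof -
  have sub: "subspace E" using E by (simp add: vector_sublattice_def)
  define G where "G = {f. atom_of E f \<and> norm f = 1}"
  have GE: "G \<subseteq> E" by (auto simp: G_def atom_of_def)
  have multiple: "\<exists>t. inf x f = t *\<^sub>R f" if "x \<in> E" "0 \<le> x" "f \<in> G" for x f
  proof -
    have "inf x f \<in> E" "0 \<le> inf x f" "inf x f \<le> f"
      using that GE by (auto simp: G_def atom_of_def intro: vector_sublattice_inf[OF E])
    then show ?thesis using that by (auto simp: G_def atom_of_def)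
  qed
  have orth: "f \<bullet> g = 0" if G: "f \<in> G" "g \<in> G" and "f \<noteq> g" for f g
  proof (rule ccontr)
    assume "f \<bullet> g \<noteq> 0"
    then have inf0: "inf f g \<noteq> 0" using disjoint_imp_orthogonal by blast
    have fg: "0 \<le> f" "0 \<le> g" "norm f = 1" "norm g = 1" "f \<in> E" "g \<in> E"
      using G unfolding G_def atom_of_def by blast+
    obtain s t where st: "inf f g = s *\<^sub>R g" "inf f g = t *\<^sub>R f"
      using multiple[OF fg(5,1) G(2)] multiple[OF fg(6,2) G(1)]
      by (auto simp: inf_commute)
    have "0 \<le> (inf f g) \<bullet> f" "0 \<le> (inf f g) \<bullet> g"
      using fg by (auto intro!: inner_nonneg)
    moreover have "inf f g \<bullet> g = s" using fg unfolding st(1) by (simp add: dot_square_norm)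
    moreover have "inf f g \<bullet> f = t" using fg unfolding st(2) by (simp add: dot_square_norm)
    ultimately have "0 \<le> s" "0 \<le> t" by simp_all
    moreover have "norm (s *\<^sub>R g) = norm (t *\<^sub>R f)" using st by simp
    ultimately have "s = t" using fg by simp
    then show False using st inf0 \<open>f \<noteq> g\<close> by auto
  qed
  have po: "positive_orthonormal G"
    using orth by (auto simp: positive_orthonormal_def pairwise_def orthogonal_def G_def atom_of_def)
  have finG: "finite G" using fin[OF GE po] .
  have abs_orth: "\<bar>x\<bar> \<bullet> f = 0" if x: "x \<in> E" "f \<in> G" "x \<bullet> f = 0" for x f
  proof -
    have f: "0 \<le> f" "norm f = 1" using x by (auto simp: G_def atom_of_def)
    have pE: "pprt x \<in> E" "- nprt x \<in> E"
      using vector_sublattice_pprt[OF E x(1)] vector_sublattice_nprt[OF E x(1)] sub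
      by (auto intro: subspace_neg)
    obtain s t where st: "inf (pprt x) f = s *\<^sub>R f" "inf (- nprt x) f = t *\<^sub>R f"
      using multiple[OF pE(1) _ x(2)] multiple[OF pE(2) _ x(2)] by auto
    have "inf (pprt x) f \<bullet> inf (- nprt x) f \<le> pprt x \<bullet> (- nprt x)"
      by (rule inner_mono; use f in simp)
    moreover have "0 \<le> inf (pprt x) f \<bullet> inf (- nprt x) f"
      by (rule inner_nonneg; use f in simp)
    ultimately have "inf (pprt x) f \<bullet> inf (- nprt x) f = 0"
      using pprt_nprt_orthogonal[of x] by simp
    then have "s * t = 0" using f by (auto simp: st dot_square_norm)
    then have "inf (pprt x) f = 0 \<or> inf (- nprt x) f = 0" unfolding st by auto
    then have "pprt x \<bullet> f = 0 \<or> - nprt x \<bullet> f = 0"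
      using disjoint_imp_orthogonal by blast
    moreover have "pprt x \<bullet> f = - nprt x \<bullet> f"
      using x(3) by (subst (asm) prts[of x]) (simp add: inner_add_left)
    ultimately show ?thesis by (simp add: abs_prts inner_diff_left)
  qed
  have trivial_complement: "x = 0" if "x \<in> E" "\<And>f. f \<in> G \<Longrightarrow> x \<bullet> f = 0" for x
  proof (rule ccontr)
    assume "x \<noteq> 0"
    then have "\<bar>x\<bar> \<in> E" "0 \<le> \<bar>x\<bar>" "\<bar>x\<bar> \<noteq> 0"
      using E that by (auto simp: vector_sublattice_def)
    then obtain f where f: "atom_of E f" "f \<le> \<bar>x\<bar>"
      using atom_or_disjoint_sequence[OF E] fin by blast
    then have f0: "0 \<le> f" "f \<noteq> 0" "f \<in> E" by (auto simp: atom_of_def)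
    define g where "g = (1 / norm f) *\<^sub>R f"
    have "g \<in> G"
    proof -
      have "atom_of E g"
        unfolding atom_of_def
      proof (intro conjI ballI impI)
        show "g \<in> E" "0 \<le> g" "g \<noteq> 0"
          using f0 sub by (auto simp: g_def scaleR_nonneg_nonneg intro: subspace_scale)
        fix y assume y: "y \<in> E" "0 \<le> y \<and> y \<le> g"
        have "norm f *\<^sub>R y \<le> norm f *\<^sub>R g" using y by (intro scaleR_left_mono) auto
        then have "norm f *\<^sub>R y \<in> E" "0 \<le> norm f *\<^sub>R y" "norm f *\<^sub>R y \<le> f"
          using y sub f0 by (auto simp: g_def scaleR_nonneg_nonneg intro: subspace_scale)
        then obtain t where "norm f *\<^sub>R y = t *\<^sub>R f" using f(1) by (auto simp: atom_of_def)
        then have "(1 / norm f) *\<^sub>R (norm f *\<^sub>R y) = t *\<^sub>R g" by (simp add: g_def)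
        then show "\<exists>t. y = t *\<^sub>R g" using f0 by auto
      qed
      then show ?thesis using f0 by (simp add: G_def g_def)
    qed
    then have "\<bar>x\<bar> \<bullet> g = 0" using abs_orth that by blast
    then have "\<bar>x\<bar> \<bullet> f = 0" using f0 by (simp add: g_def)
    moreover have "f \<bullet> f \<le> \<bar>x\<bar> \<bullet> f" using f f0 by (intro inner_mono) auto
    ultimately have "f \<bullet> f \<le> 0" by simp
    then show False using f0 by (metis antisym inner_eq_zero_iff inner_ge_zero)
  qed
  have "x \<in> span G" if "x \<in> E" for x
  proof -
    define p where "p = (\<Sum>g\<in>G. (x \<bullet> g) *\<^sub>R g)"
    have pG: "p \<in> span G" unfolding p_def by (intro span_sum span_scale span_base)
    have "span G \<subseteq> E" using GE sub by (rule span_minimal)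
    have "(x - p) \<bullet> f = 0" if f: "f \<in> G" for f
    proof -
      have "p \<bullet> f = (\<Sum>g\<in>G. if g = f then x \<bullet> f else 0)"
        unfolding p_def inner_sum_left
        using f po by (intro sum.cong) (auto simp: orth positive_orthonormal_def dot_square_norm)
      then show ?thesis using finG f by (simp add: inner_diff_left)
    qed
    moreover have "x - p \<in> E"
      using that pG \<open>span G \<subseteq> E\<close> sub by (auto intro: subspace_diff)
    ultimately have "x - p = 0" by (intro trivial_complement) auto
    then show ?thesis using pG by simp
  qed
  then show thesis using that[OF GE finG po] by blast
qed

section \<open>Compact self-adjoint operators\<close>

lemma compact_operator_convergent_subsequence:
  assumes "compact_operator C" "\<And>n::nat. norm (x n) \<le> 1"
  obtains r y where "strict_mono r" "(\<lambda>n. C (x (r n))) \<longlonglongrightarrow> y"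
proof -
  have "bounded (range x)" using assms(2) by (auto simp: bounded_iff)
  then have "compact (closure (C ` range x))"
    using assms(1) by (simp add: compact_operator_def)
  moreover have "C (x n) \<in> closure (C ` range x)" for n
    by (rule subsetD[OF closure_subset]) blast
  ultimately obtain y r where "strict_mono r" "((\<lambda>n. C (x n)) \<circ> r) \<longlonglongrightarrow> y"
    unfolding compact_def by metis
  then show thesis using that by (simp add: o_def)
qed

text \<open>With \<open>m\<close> the norm of \<open>C\<close> on \<open>K\<close> and \<open>x n\<close> unit vectors in \<open>K\<close> along which
  \<open>norm (C (x n))\<close> tends to \<open>m\<close>, self-adjointness gives
  \<open>norm (C (C (x n)) - m\<^sup>2 x n)\<^sup>2 \<le> m\<^sup>4 - m\<^sup>2 norm (C (x n))\<^sup>2\<close>, which tends to zero. Compactness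
  then makes a subsequence of \<open>x n\<close> converge to some \<open>x\<close> with \<open>C (C x) = m\<^sup>2 x\<close>, and
  \<open>C x + m x\<close> is the eigenvector; it is not zero since \<open>C\<close> is semidefinite.\<close>

lemma compact_self_adjoint_eigenvector:
  fixes C :: "'a::real_inner \<Rightarrow> 'a"
  assumes lin: "bounded_linear C" and cpt: "compact_operator C"
    and self: "\<And>x y. C x \<bullet> y = x \<bullet> C y" and semi: "\<And>x. 0 \<le> C x \<bullet> x"
    and K: "subspace K" "closed K" "\<And>x. x \<in> K \<Longrightarrow> C x \<in> K"
    and x0: "x0 \<in> K" "C x0 \<noteq> 0"
  obtains m z where "0 < m" "z \<in> K" "z \<noteq> 0" "C z = m *\<^sub>R z"
proof -
  interpret bounded_linear C by fact
  define S where "S = {norm (C x) | x. x \<in> K \<and> norm x = 1}"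
  define m where "m = Sup S"
  have bdd: "bdd_above S"
  proof (rule bdd_aboveI)
    show "s \<le> onorm C" if s: "s \<in> S" for s
    proof -
      obtain x where "s = norm (C x)" "norm x = 1" using s by (auto simp: S_def)
      then show ?thesis using onorm[OF lin, of x] by simp
    qed
  qed
  have unit_S: "norm (C ((1 / norm x) *\<^sub>R x)) \<in> S" if "x \<in> K" "x \<noteq> 0" for x
    unfolding S_def using that K(1)
    by (auto intro!: exI[of _ "(1 / norm x) *\<^sub>R x"] subspace_scale)
  have bound: "norm (C x) \<le> m * norm x" if "x \<in> K" for x
  proof (cases "x = 0")
    case False
    then have "norm (C ((1 / norm x) *\<^sub>R x)) \<le> m"
      unfolding m_def using unit_S[OF that] bdd by (intro cSup_upper) auto
    then show ?thesis using False by (simp add: scaleR field_simps)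
  qed (simp add: zero)
  have "0 < norm (C x0)" using x0 by simp
  then have "0 < m * norm x0" using bound[OF x0(1)] by linarith
  then have m: "0 < m" by (simp add: zero_less_mult_iff)
  have "x0 \<noteq> 0" using x0 zero by auto
  then have "S \<noteq> {}" using unit_S x0 by auto
  have "\<exists>x. x \<in> K \<and> norm x = 1 \<and> m - inverse (real (Suc n)) < norm (C x)" for n
  proof -
    have "m - inverse (real (Suc n)) < Sup S" by (simp add: m_def)
    then obtain s where "s \<in> S" "m - inverse (real (Suc n)) < s"
      using \<open>S \<noteq> {}\<close> bdd by (auto simp: less_cSup_iff)
    then show ?thesis by (auto simp: S_def)
  qed
  then obtain x where x: "\<And>n. x n \<in> K" "\<And>n. norm (x n) = 1"
      "\<And>n. m - inverse (real (Suc n)) < norm (C (x n))"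
    by metis
  have norm_lim: "(\<lambda>n. norm (C (x n))) \<longlonglongrightarrow> m"
  proof (rule tendsto_sandwich)
    show "(\<lambda>n. m - inverse (real (Suc n))) \<longlonglongrightarrow> m"
      using tendsto_diff[OF tendsto_const LIMSEQ_inverse_real_of_nat, of m] by simp
    show "eventually (\<lambda>n. m - inverse (real (Suc n)) \<le> norm (C (x n))) sequentially"
      by (intro always_eventually allI less_imp_le x(3))
    show "eventually (\<lambda>n. norm (C (x n)) \<le> m) sequentially"
    proof (intro always_eventually allI)
      show "norm (C (x n)) \<le> m" for n using bound[OF x(1), of n] x(2)[of n] by simp
    qed
  qed simp
  obtain r y where r: "strict_mono r" "(\<lambda>n. C (x (r n))) \<longlonglongrightarrow> y"
    using compact_operator_convergent_subsequence[OF cpt] x(2) by (metis order_refl)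
  define v where "v n = C (C (x n)) - m\<^sup>2 *\<^sub>R x n" for n
  have v_bound: "(norm (v n))\<^sup>2 \<le> m ^ 4 - m\<^sup>2 * (norm (C (x n)))\<^sup>2" for n
  proof -
    have "(norm (C (C (x n))))\<^sup>2 \<le> (m * norm (C (x n)))\<^sup>2"
      using bound[OF K(3)[OF x(1)]] by (intro power_mono) auto
    moreover have "(norm (v n))\<^sup>2 = (norm (C (C (x n))))\<^sup>2 - 2 * m\<^sup>2 * (norm (C (x n)))\<^sup>2 + m ^ 4"
    proof -
      have "x n \<bullet> C (C (x n)) = C (x n) \<bullet> C (x n)" by (rule self[symmetric])
      moreover have "x n \<bullet> x n = 1" using x(2)[of n] by (simp add: norm_eq_1)
      moreover have "m ^ 4 = m\<^sup>2 * m\<^sup>2" by simp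
      ultimately show ?thesis
        unfolding v_def power2_norm_eq_inner
        by (simp add: inner_diff_left inner_diff_right inner_commute)
    qed
    ultimately show ?thesis by (simp add: power_mult_distrib)
  qed
  have v_lim: "v \<longlonglongrightarrow> 0"
  proof -
    have "(\<lambda>n. m ^ 4 - m\<^sup>2 * (norm (C (x n)))\<^sup>2) \<longlonglongrightarrow> m ^ 4 - m\<^sup>2 * m\<^sup>2"
      by (intro tendsto_intros norm_lim)
    then have "(\<lambda>n. m ^ 4 - m\<^sup>2 * (norm (C (x n)))\<^sup>2) \<longlonglongrightarrow> 0"
      by (simp add: power4_eq_xxxx power2_eq_square)
    then have "(\<lambda>n. (norm (v n))\<^sup>2) \<longlonglongrightarrow> 0"
      by (rule tendsto_sandwich[OF always_eventually always_eventually tendsto_const, rotated 2])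
        (simp_all add: v_bound)
    then have "(\<lambda>n. sqrt ((norm (v n))\<^sup>2)) \<longlonglongrightarrow> sqrt 0" by (rule tendsto_real_sqrt)
    then show ?thesis by (simp add: tendsto_norm_zero_iff)
  qed
  have "(\<lambda>n. v (r n)) \<longlonglongrightarrow> 0"
    using LIMSEQ_subseq_LIMSEQ[OF v_lim r(1)] by (simp add: o_def)
  moreover have "(\<lambda>n. C (C (x (r n)))) \<longlonglongrightarrow> C y" by (rule tendsto[OF r(2)])
  ultimately have "(\<lambda>n. (1 / m\<^sup>2) *\<^sub>R (C (C (x (r n))) - v (r n))) \<longlonglongrightarrow> (1 / m\<^sup>2) *\<^sub>R (C y - 0)"
    by (intro tendsto_intros)
  then have lim: "(\<lambda>n. x (r n)) \<longlonglongrightarrow> (1 / m\<^sup>2) *\<^sub>R C y"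
    using m by (simp add: v_def)
  define u where "u = (1 / m\<^sup>2) *\<^sub>R C y"
  have uK: "u \<in> K"
    using closed_sequentially[OF K(2) _ lim] x(1) by (simp add: u_def)
  have "(\<lambda>n. norm (x (r n))) \<longlonglongrightarrow> norm u"
    unfolding u_def by (rule tendsto_norm[OF lim])
  then have u1: "norm u = 1" using x(2) by (simp add: LIMSEQ_const_iff)
  have "C u = y"
    unfolding u_def by (rule LIMSEQ_unique[OF tendsto[OF lim] r(2)])
  then have CCu: "C (C u) = m\<^sup>2 *\<^sub>R u" using m by (simp add: u_def)
  show thesis
  proof (rule that[OF m])
    show "C u + m *\<^sub>R u \<in> K"
      using uK K by (intro subspace_add subspace_scale) auto
    show "C (C u + m *\<^sub>R u) = m *\<^sub>R (C u + m *\<^sub>R u)"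
      by (simp add: add scaleR CCu algebra_simps power2_eq_square)
    show "C u + m *\<^sub>R u \<noteq> 0"
    proof
      assume "C u + m *\<^sub>R u = 0"
      then have "(C u + m *\<^sub>R u) \<bullet> u = 0" by simp
      then have "C u \<bullet> u = - m" using u1 by (simp add: inner_add_left dot_square_norm)
      then show False using semi[of u] m by simp
    qed
  qed
qed

text \<open>An orthonormal sequence of eigenvectors with eigenvalues at least \<open>e\<close> would be mapped
  to a sequence with mutual distances at least \<open>e\<close>.\<close>

lemma finite_large_eigenvalues:
  fixes C :: "'a::real_inner \<Rightarrow> 'a"
  assumes cpt: "compact_operator C" and e: "0 < e"
    and F: "pairwise orthogonal F" "\<And>f. f \<in> F \<Longrightarrow> norm f = 1"
    and eig: "\<And>f. f \<in> F \<Longrightarrow> \<exists>c\<ge>e. C f = c *\<^sub>R f"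
  shows "finite F"
proof (rule ccontr)
  assume "infinite F"
  then obtain s :: "nat \<Rightarrow> 'a" where s: "inj s" "range s \<subseteq> F"
    using infinite_countable_subset by blast
  then have sF: "s n \<in> F" for n by blast
  obtain r y where r: "strict_mono r" "(\<lambda>n. C (s (r n))) \<longlonglongrightarrow> y"
    using compact_operator_convergent_subsequence[OF cpt, of s] F(2)[OF sF] by auto
  have "Cauchy (\<lambda>n. C (s (r n)))" using r(2) by (rule LIMSEQ_imp_Cauchy)
  then obtain M where M: "dist (C (s (r M))) (C (s (r (Suc M)))) < e"
    unfolding Cauchy_def using e by (meson le_SucI order_refl)
  obtain c d where cd: "e \<le> c" "C (s (r M)) = c *\<^sub>R s (r M)" "e \<le> d" "C (s (r (Suc M))) = d *\<^sub>R s (r (Suc M))"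
    using eig[OF sF] by metis
  have "r M \<noteq> r (Suc M)" using r(1) by (metis less_irrefl lessI strict_monoD)
  then have "s (r M) \<noteq> s (r (Suc M))" using s(1) by (auto dest: injD)
  then have "s (r M) \<bullet> s (r (Suc M)) = 0"
    using F(1) sF by (auto simp: pairwise_def orthogonal_def)
  moreover have "s n \<bullet> s n = 1" for n using F(2)[OF sF[of n]] by (simp add: norm_eq_1)
  ultimately have "(dist (C (s (r M))) (C (s (r (Suc M)))))\<^sup>2 = c * c + d * d"
    unfolding dist_norm cd power2_norm_eq_inner
    by (simp add: inner_diff_left inner_diff_right inner_commute)
  moreover have "e * e \<le> c * c" using cd e by (intro mult_mono) auto
  moreover have "0 \<le> d * d" by simp
  ultimately have "e * e \<le> (dist (C (s (r M))) (C (s (r (Suc M)))))\<^sup>2" by linarith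
  then have "e\<^sup>2 \<le> (dist (C (s (r M))) (C (s (r (Suc M)))))\<^sup>2" by (simp add: power2_eq_square)
  then have "e \<le> dist (C (s (r M))) (C (s (r (Suc M))))"
    by (rule power2_le_imp_le) simp
  then show False using M by simp
qed

section \<open>Diagonalisation by positive vectors\<close>

lemma vector_sublattice_eigenspace:
  fixes C :: "'a::hilbert_lattice \<Rightarrow> 'a"
  assumes lin: "bounded_linear C" and "positive_operator C" "central_operator C" and "0 \<le> c"
  shows "vector_sublattice {x. C x = c *\<^sub>R x}"
proof -
  interpret bounded_linear C by fact
  have "C \<bar>x\<bar> = c *\<^sub>R \<bar>x\<bar>" if "C x = c *\<^sub>R x" for x
    using positive_central_abs[OF assms(1-3), of x] that abs_scaleR_nonneg[OF assms(4)] by metis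
  then show ?thesis
    by (auto simp: vector_sublattice_def subspace_def add zero scaleR scaleR_add_right)
qed

text \<open>Each eigenspace for a positive eigenvalue is a sublattice, by compactness without infinite
  disjoint families, hence has a positive orthonormal basis, and eigenvectors for different eigenvalues
  are orthogonal. The orthogonal complement of all these bases is invariant and contains no
  further eigenvector, so \<open>C\<close> vanishes on it. When there are only finitely many of them, the kernel
  of \<open>C\<close> is a sublattice of finite codimension and must contain an infinite positive orthonormal
  family, which is then added with eigenvalue zero.\<close>

lemma positive_orthonormal_eigenvectors:
  fixes C :: "'a::hilbert_lattice \<Rightarrow> 'a"
  assumes infinite_dim: "\<nexists>B :: 'a set. finite B \<and> span B = UNIV"
    and lin: "bounded_linear C" and pos: "positive_operator C"
    and cpt: "compact_operator C" and cent: "central_operator C"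
  obtains F where "positive_orthonormal F" "countable F" "infinite F"
    "\<And>f. f \<in> F \<Longrightarrow> \<exists>c\<ge>0. C f = c *\<^sub>R f"
    "\<And>x. (\<And>f. f \<in> F \<Longrightarrow> x \<bullet> f = 0) \<Longrightarrow> C x = 0"
proof -
  interpret bounded_linear C by fact
  note self = positive_central_self_adjoint[OF lin pos cent]
  define E where "E c = {x. C x = c *\<^sub>R x}" for c
  have lat: "vector_sublattice (E c)" if "0 \<le> c" for c
    unfolding E_def by (rule vector_sublattice_eigenspace[OF lin pos cent that])
  have "\<exists>G. 0 < c \<longrightarrow> G \<subseteq> E c \<and> finite G \<and> positive_orthonormal G \<and> E c \<subseteq> span G" for c
  proof (cases "0 < c")
    case True
    have "finite G" if "G \<subseteq> E c" "positive_orthonormal G" for G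
      by (rule finite_large_eigenvalues[OF cpt True])
        (use that in \<open>auto simp: E_def positive_orthonormal_def\<close>)
    then show ?thesis
      using finite_positive_basis[OF lat[of c]] True by (metis less_imp_le)
  qed auto
  then obtain G where G: "\<And>c. 0 < c \<Longrightarrow> G c \<subseteq> E c \<and> finite (G c) \<and> positive_orthonormal (G c) \<and> E c \<subseteq> span (G c)"
    by metis
  define F where "F = (\<Union>c\<in>{0<..}. G c)"
  have F_E: "\<exists>c>0. f \<in> G c \<and> C f = c *\<^sub>R f" if "f \<in> F" for f
    using that G unfolding F_def E_def by blast
  have orth_E: "x \<bullet> y = 0" if "C x = c *\<^sub>R x" "C y = d *\<^sub>R y" "c \<noteq> d" for x y c d
    using self[of x y] that by simp
  have F: "positive_orthonormal F"
    unfolding positive_orthonormal_def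
  proof (intro conjI ballI pairwiseI)
    show "0 \<le> f" "norm f = 1" if "f \<in> F" for f
      using F_E[OF that] G by (auto simp: positive_orthonormal_def)
    fix f g assume fg: "f \<in> F" "g \<in> F" "f \<noteq> g"
    obtain c d where cd: "0 < c" "f \<in> G c" "C f = c *\<^sub>R f" "0 < d" "g \<in> G d" "C g = d *\<^sub>R g"
      using F_E[OF fg(1)] F_E[OF fg(2)] by blast
    show "orthogonal f g"
    proof (cases "c = d")
      case True
      then show ?thesis using G[OF cd(1)] cd fg by (auto simp: positive_orthonormal_def pairwise_def)
    next
      case False
      then show ?thesis using orth_E cd by (auto simp: orthogonal_def)
    qed
  qed
  have complement: "C x = 0" if "\<And>f. f \<in> F \<Longrightarrow> x \<bullet> f = 0" for x
  proof (rule ccontr)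
    assume "C x \<noteq> 0"
    define K where "K = (\<Inter>f\<in>F. {x. f \<bullet> x = 0})"
    have "subspace K" by (auto simp: K_def subspace_def inner_add_right)
    moreover have "closed K" unfolding K_def by (intro closed_INT ballI closed_hyperplane)
    moreover have "C y \<in> K" if "y \<in> K" for y
      using that F_E self[of _ y, symmetric] by (fastforce simp: K_def)
    moreover have "x \<in> K" using that by (simp add: K_def inner_commute)
    ultimately obtain m z where z: "0 < m" "z \<in> K" "z \<noteq> 0" "C z = m *\<^sub>R z"
      using compact_self_adjoint_eigenvector[OF lin cpt self positive_central_semidefinite[OF lin pos cent]]
        \<open>C x \<noteq> 0\<close> by metis
    then have "z \<in> span (G m)" using G by (auto simp: E_def)
    moreover have "orthogonal z g" if "g \<in> G m" for g
      using z that by (auto simp: K_def F_def orthogonal_def inner_commute)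
    ultimately have "orthogonal z z" using orthogonal_to_span by blast
    then show False using z by (simp add: orthogonal_def)
  qed
  define F_above where "F_above n = {f \<in> F. \<exists>c\<ge>inverse (real (Suc n)). C f = c *\<^sub>R f}" for n
  have "finite (F_above n)" for n
    by (rule finite_large_eigenvalues[OF cpt, of "inverse (real (Suc n))"])
      (use F in \<open>auto simp: F_above_def positive_orthonormal_def intro: pairwise_subset\<close>)
  then have "countable (\<Union>n. F_above n)" by (intro countable_UN) (auto intro: countable_finite)
  moreover have "F \<subseteq> (\<Union>n. F_above n)"
  proof
    fix f assume f: "f \<in> F"
    then obtain c where c: "0 < c" "C f = c *\<^sub>R f" using F_E by blast
    then obtain n where "inverse (real (Suc n)) < c" using reals_Archimedean by blast
    then have "f \<in> F_above n" using c f by (auto simp: F_above_def intro!: exI[of _ c])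
    then show "f \<in> (\<Union>n. F_above n)" by blast
  qed
  ultimately have count: "countable F" by (rule countable_subset[rotated])
  show thesis
  proof (cases "finite F")
    case False
    show thesis
    proof (rule that[OF F count False])
      show "\<exists>c\<ge>0. C f = c *\<^sub>R f" if "f \<in> F" for f
        using F_E[OF that] by (auto intro: less_imp_le)
    qed (rule complement)
  next
    case True
    have "\<exists>H. H \<subseteq> E 0 \<and> positive_orthonormal H \<and> infinite H"
    proof (rule ccontr)
      assume "\<nexists>H. H \<subseteq> E 0 \<and> positive_orthonormal H \<and> infinite H"
      then have "finite H" if "H \<subseteq> E 0" "positive_orthonormal H" for H
        using that by blast
      then obtain H where H: "finite H" "E 0 \<subseteq> span H"
        using finite_positive_basis[OF lat[OF order_refl]] by metis
      have "x \<in> span (F \<union> H)" for x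
      proof -
        define p where "p = (\<Sum>g\<in>F. (x \<bullet> g) *\<^sub>R g)"
        have "p \<in> span (F \<union> H)" unfolding p_def by (intro span_sum span_scale span_base) simp
        moreover have "C (x - p) = 0"
        proof (rule complement)
          fix f assume f: "f \<in> F"
          have "p \<bullet> f = (\<Sum>g\<in>F. if g = f then x \<bullet> f else 0)"
            unfolding p_def inner_sum_left
            using f F by (intro sum.cong)
              (auto simp: positive_orthonormal_def dot_square_norm pairwise_def orthogonal_def)
          then show "(x - p) \<bullet> f = 0" using True f by (simp add: inner_diff_left)
        qed
        then have "x - p \<in> span H" using H(2) by (auto simp: E_def)
        then have "x - p \<in> span (F \<union> H)" using span_mono[of H "F \<union> H"] by auto
        ultimately show ?thesis using span_add[of "x - p" "F \<union> H" p] by simp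
      qed
      then have "span (F \<union> H) = UNIV" by auto
      then show False using infinite_dim True H(1) by blast
    qed
    then obtain H where H: "H \<subseteq> E 0" "positive_orthonormal H" "infinite H" by blast
    then obtain s :: "nat \<Rightarrow> 'a" where s: "inj s" "range s \<subseteq> H"
      using infinite_countable_subset by blast
    have Cs: "C (s n) = 0" for n using s(2) H(1) by (auto simp: E_def)
    show thesis
    proof (rule that)
      show "countable (F \<union> range s)" using count by simp
      show "infinite (F \<union> range s)" using s(1) finite_imageD by auto
      show "\<exists>c\<ge>0. C f = c *\<^sub>R f" if "f \<in> F \<union> range s" for f
        using that F_E[of f] Cs by (auto intro: less_imp_le)
      show "C x = 0" if "\<And>f. f \<in> F \<union> range s \<Longrightarrow> x \<bullet> f = 0" for x
        using that complement by blast
      have Fs: "orthogonal f (s n)" if "f \<in> F" for f n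
        using F_E[OF that] orth_E[of f _ "s n" 0] Cs by (auto simp: orthogonal_def)
      have "pairwise orthogonal (range s)"
        using H(2) s(2) by (auto simp: positive_orthonormal_def intro: pairwise_subset)
      then have "pairwise orthogonal (F \<union> range s)"
        using F Fs by (auto simp: positive_orthonormal_def pairwise_def orthogonal_commute)
      then show "positive_orthonormal (F \<union> range s)"
        using F H(2) s(2) by (auto simp: positive_orthonormal_def)
    qed
  qed
qed

definition orthonormal_sequence :: "(nat \<Rightarrow> 'a::real_inner) \<Rightarrow> bool" where
  "orthonormal_sequence f \<longleftrightarrow> (\<forall>i j. f i \<bullet> f j = (if i = j then 1 else 0))"

text \<open>Enumerating the eigenvectors, the eigenvalues tend to zero because only finitely many
  of them can exceed a given positive bound.\<close>

lemma positive_diagonalisation: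
  fixes C :: "'a::hilbert_lattice \<Rightarrow> 'a"
  assumes infinite_dim: "\<nexists>B :: 'a set. finite B \<and> span B = UNIV"
    and lin: "bounded_linear C" and pos: "positive_operator C"
    and cpt: "compact_operator C" and cent: "central_operator C"
  obtains f :: "nat \<Rightarrow> 'a" and c :: "nat \<Rightarrow> real"
  where "orthonormal_sequence f" "\<And>n. 0 \<le> f n" "\<And>n. C (f n) = c n *\<^sub>R f n"
    "\<And>n. 0 \<le> c n" "c \<longlonglongrightarrow> 0" "\<And>x. (\<And>n. x \<bullet> f n = 0) \<Longrightarrow> C x = 0"
proof -
  obtain F where F: "positive_orthonormal F" "countable F" "infinite F"
    "\<And>f. f \<in> F \<Longrightarrow> \<exists>c\<ge>0. C f = c *\<^sub>R f"
    "\<And>x. (\<And>f. f \<in> F \<Longrightarrow> x \<bullet> f = 0) \<Longrightarrow> C x = 0"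
    using positive_orthonormal_eigenvectors[OF assms] by metis
  define f where "f = from_nat_into F"
  have f: "bij_betw f UNIV F"
    unfolding f_def using F(2,3) by (rule bij_betw_from_nat_into)
  then have fF: "f n \<in> F" and inj: "inj f" and ran: "range f = F" for n
    by (auto simp: bij_betw_def)
  obtain c where c: "\<And>n. 0 \<le> c n" "\<And>n. C (f n) = c n *\<^sub>R f n"
    using F(4)[OF fF] by metis
  have on: "orthonormal_sequence f"
    unfolding orthonormal_sequence_def
  proof (intro allI)
    fix i j
    show "f i \<bullet> f j = (if i = j then 1 else 0)"
      using F(1) fF[of i] fF[of j] injD[OF inj, of i j]
      by (auto simp: positive_orthonormal_def pairwise_def orthogonal_def norm_eq_1)
  qed
  have "c \<longlonglongrightarrow> 0"
  proof (rule LIMSEQ_I)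
    fix e :: real assume e: "0 < e"
    have "finite {g \<in> F. \<exists>c\<ge>e. C g = c *\<^sub>R g}"
      by (rule finite_large_eigenvalues[OF cpt e])
        (use F(1) in \<open>auto simp: positive_orthonormal_def intro: pairwise_subset\<close>)
    then have "finite (f -` {g \<in> F. \<exists>c\<ge>e. C g = c *\<^sub>R g})"
      using inj by (rule finite_vimageI)
    moreover have "{n. e \<le> c n} \<subseteq> f -` {g \<in> F. \<exists>c\<ge>e. C g = c *\<^sub>R g}"
      using fF c(2) by auto
    ultimately have "finite {n. e \<le> c n}" by (rule rev_finite_subset)
    then obtain N where "\<forall>n\<in>{n. e \<le> c n}. n < N" using finite_nat_set_iff_bounded by blast
    then have "\<forall>n\<ge>N. norm (c n - 0) < e" using c(1) by (force simp: not_le[symmetric])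
    then show "\<exists>N. \<forall>n\<ge>N. norm (c n - 0) < e" by blast
  qed
  moreover have "C x = 0" if "\<And>n. x \<bullet> f n = 0" for x
    using F(5)[of x] that ran by auto
  ultimately show thesis
    using that[OF on _ c(2) c(1)] F(1) fF by (auto simp: positive_orthonormal_def)
qed

section \<open>Orthonormal series\<close>

lemma norm_orthonormal_sum:
  assumes "orthonormal_sequence g" "finite I"
  shows "(norm (\<Sum>i\<in>I. a i *\<^sub>R g i))\<^sup>2 = (\<Sum>i\<in>I. (a i)\<^sup>2)"
proof -
  have "(norm (\<Sum>i\<in>I. a i *\<^sub>R g i))\<^sup>2 = (\<Sum>i\<in>I. \<Sum>j\<in>I. if j = i then a i * a i else 0)"
    unfolding power2_norm_eq_inner inner_sum_left inner_sum_right
    using assms(1) by (intro sum.cong refl) (auto simp: orthonormal_sequence_def)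
  then show ?thesis using assms(2) by (simp add: power2_eq_square)
qed

lemma summable_orthonormal:
  fixes g :: "nat \<Rightarrow> 'a::{real_inner,complete_space}"
  assumes g: "orthonormal_sequence g" and a: "summable (\<lambda>n. (a n)\<^sup>2)"
  shows "summable (\<lambda>n. a n *\<^sub>R g n)"
proof -
  have "Cauchy (\<lambda>n. \<Sum>k<n. a k *\<^sub>R g k)"
  proof (rule CauchyI')
    fix e :: real assume e: "0 < e"
    then obtain N where N: "\<And>m n. N \<le> m \<Longrightarrow> norm (\<Sum>k=m..<n. (a k)\<^sup>2) < e\<^sup>2"
      using a unfolding summable_Cauchy by (meson zero_less_power)
    have "dist (\<Sum>k<m. a k *\<^sub>R g k) (\<Sum>k<n. a k *\<^sub>R g k) < e" if "N \<le> m" "m < n" for m n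
    proof -
      have "dist (\<Sum>k<m. a k *\<^sub>R g k) (\<Sum>k<n. a k *\<^sub>R g k) = norm (\<Sum>k=m..<n. a k *\<^sub>R g k)"
        using that sum_diff_nat_ivl[of 0 m n "\<lambda>k. a k *\<^sub>R g k"]
        by (simp add: lessThan_atLeast0 dist_norm) (metis norm_minus_commute)
      moreover have "(norm (\<Sum>k=m..<n. a k *\<^sub>R g k))\<^sup>2 < e\<^sup>2"
        using N[OF that(1), of n] by (simp add: norm_orthonormal_sum[OF g])
      then have "norm (\<Sum>k=m..<n. a k *\<^sub>R g k) < e"
        by (rule power_less_imp_less_base) (use e in simp)
      ultimately show ?thesis by simp
    qed
    then show "\<exists>M. \<forall>m\<ge>M. \<forall>n>m. dist (\<Sum>k<m. a k *\<^sub>R g k) (\<Sum>k<n. a k *\<^sub>R g k) < e"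
      by blast
  qed
  then show ?thesis by (simp add: summable_iff_convergent Cauchy_convergent)
qed

lemma bessel_inequality:
  assumes f: "orthonormal_sequence f"
  shows "(\<Sum>k<n. (f k \<bullet> x)\<^sup>2) \<le> (norm x)\<^sup>2"
proof -
  define p where "p = (\<Sum>k<n. (f k \<bullet> x) *\<^sub>R f k)"
  have "p \<bullet> x = (\<Sum>k<n. (f k \<bullet> x)\<^sup>2)"
    by (simp add: p_def inner_sum_left power2_eq_square)
  moreover have "p \<bullet> p = (\<Sum>k<n. (f k \<bullet> x)\<^sup>2)"
    unfolding p_def using norm_orthonormal_sum[OF f] by (simp add: power2_norm_eq_inner)
  moreover have "0 \<le> (x - p) \<bullet> (x - p)" by simp
  ultimately show ?thesis
    by (simp add: power2_norm_eq_inner inner_diff_left inner_diff_right inner_commute)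
qed

text \<open>For orthonormal \<open>f\<close> and \<open>g\<close> and bounded \<open>w\<close> this is the bounded operator that sends each
  \<open>f n\<close> to \<open>w n g n\<close> and vanishes on the orthogonal complement of \<open>f\<close>.\<close>

definition diagonal_map :: "(nat \<Rightarrow> real) \<Rightarrow> (nat \<Rightarrow> 'a) \<Rightarrow> (nat \<Rightarrow> 'a) \<Rightarrow> 'a \<Rightarrow> 'a::real_inner" where
  "diagonal_map w f g x = (\<Sum>n. (w n * (f n \<bullet> x)) *\<^sub>R g n)"

context
  fixes w :: "nat \<Rightarrow> real" and M :: real
    and f g :: "nat \<Rightarrow> 'a::{real_inner,complete_space}"
  assumes f: "orthonormal_sequence f" and g: "orthonormal_sequence g"
    and w: "\<And>n. \<bar>w n\<bar> \<le> M"
begin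

lemma diagonal_map_coefficients_le:
  "(\<Sum>k<n. (w k * (f k \<bullet> x))\<^sup>2) \<le> (M * norm x)\<^sup>2"
proof -
  have "(w k)\<^sup>2 \<le> M\<^sup>2" for k using power_mono[OF w[of k], of 2] by simp
  then have "(\<Sum>k<n. (w k * (f k \<bullet> x))\<^sup>2) \<le> (\<Sum>k<n. M\<^sup>2 * (f k \<bullet> x)\<^sup>2)"
    by (intro sum_mono) (simp add: power_mult_distrib mult_right_mono)
  also have "\<dots> \<le> M\<^sup>2 * (norm x)\<^sup>2"
    unfolding sum_distrib_left[symmetric] by (intro mult_left_mono bessel_inequality f) simp
  finally show ?thesis by (simp add: power_mult_distrib)
qed

lemma diagonal_map_summable: "summable (\<lambda>n. (w n * (f n \<bullet> x)) *\<^sub>R g n)"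
proof (rule summable_orthonormal[OF g])
  show "summable (\<lambda>n. (w n * (f n \<bullet> x))\<^sup>2)"
    by (rule summableI_nonneg_bounded[of _ "(M * norm x)\<^sup>2"])
      (auto intro: diagonal_map_coefficients_le)
qed

lemma bounded_linear_diagonal_map: "bounded_linear (diagonal_map w f g)"
proof (rule bounded_linear_intro[of _ M])
  fix x y :: 'a and r :: real
  show "diagonal_map w f g (x + y) = diagonal_map w f g x + diagonal_map w f g y"
    unfolding diagonal_map_def
    by (subst suminf_add[OF diagonal_map_summable diagonal_map_summable])
      (simp add: inner_add_right algebra_simps)
  show "diagonal_map w f g (r *\<^sub>R x) = r *\<^sub>R diagonal_map w f g x"
    unfolding diagonal_map_def
    by (subst suminf_scaleR_right[OF diagonal_map_summable])
      (simp add: algebra_simps)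
  have "(\<lambda>n. norm (\<Sum>k<n. (w k * (f k \<bullet> x)) *\<^sub>R g k)) \<longlonglongrightarrow> norm (diagonal_map w f g x)"
    unfolding diagonal_map_def by (intro tendsto_norm summable_LIMSEQ diagonal_map_summable)
  moreover have "norm (\<Sum>k<n. (w k * (f k \<bullet> x)) *\<^sub>R g k) \<le> M * norm x" for n
  proof (rule power2_le_imp_le)
    show "(norm (\<Sum>k<n. (w k * (f k \<bullet> x)) *\<^sub>R g k))\<^sup>2 \<le> (M * norm x)\<^sup>2"
      by (simp add: norm_orthonormal_sum[OF g] diagonal_map_coefficients_le)
    show "0 \<le> M * norm x" using w[of 0] by simp
  qed
  ultimately have "norm (diagonal_map w f g x) \<le> M * norm x"
    by (blast intro: LIMSEQ_le_const2)
  then show "norm (diagonal_map w f g x) \<le> norm x * M" by (simp add: mult.commute)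
qed

lemma inner_diagonal_map:
  "diagonal_map w f g x \<bullet> y = (\<Sum>n. w n * (f n \<bullet> x) * (g n \<bullet> y))"
  unfolding diagonal_map_def
  by (subst bounded_linear.suminf[OF bounded_linear_inner_left diagonal_map_summable]) simp

end

lemma diagonal_map_adjoint:
  fixes f g :: "nat \<Rightarrow> 'a::{real_inner,complete_space}"
  assumes "orthonormal_sequence f" "orthonormal_sequence g" "\<And>n. \<bar>w n\<bar> \<le> M"
  shows "diagonal_map w f g x \<bullet> y = x \<bullet> diagonal_map w g f y"
proof -
  have "x \<bullet> diagonal_map w g f y = diagonal_map w g f y \<bullet> x" by (rule inner_commute)
  then show ?thesis
    by (simp add: inner_diagonal_map[OF assms] inner_diagonal_map[OF assms(2,1,3)] mult_ac)
qed

lemma diagonal_map_basis: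
  assumes "orthonormal_sequence f"
  shows "diagonal_map w f g (f m) = w m *\<^sub>R g m"
proof -
  have "(\<lambda>n. (w n * (f n \<bullet> f m)) *\<^sub>R g n) = (\<lambda>n. if n = m then w n *\<^sub>R g n else 0)"
    using assms by (auto simp: orthonormal_sequence_def)
  then show ?thesis
    unfolding diagonal_map_def using sums_single[of m "\<lambda>n. w n *\<^sub>R g n"] by (simp add: sums_iff)
qed

lemma diagonal_map_complement:
  assumes "\<And>n. f n \<bullet> x = 0"
  shows "diagonal_map w f g x = 0"
  using assms by (simp add: diagonal_map_def)

text \<open>The orthogonal projection onto the closed span of \<open>f\<close> is the diagonal map with all weights
  equal to one, so a bounded operator is determined by its values on \<open>f\<close> and on its complement.\<close>

lemma bounded_linear_eqI_orthonormal:
  fixes f :: "nat \<Rightarrow> 'a::{real_inner,complete_space}"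
  assumes f: "orthonormal_sequence f" and S: "bounded_linear S" and T: "bounded_linear T"
    and basis: "\<And>n. S (f n) = T (f n)"
    and complement: "\<And>x. (\<And>n. x \<bullet> f n = 0) \<Longrightarrow> S x = T x"
  shows "S = T"
proof
  fix x
  interpret S: bounded_linear S by fact
  interpret T: bounded_linear T by fact
  define p where "p = diagonal_map (\<lambda>_. 1) f f x"
  have sm: "summable (\<lambda>n. (f n \<bullet> x) *\<^sub>R f n)"
    using diagonal_map_summable[OF f f, of "\<lambda>_. 1" 1 x] by simp
  have "p \<bullet> f n = x \<bullet> f n" for n
    unfolding p_def using diagonal_map_adjoint[OF f f, of "\<lambda>_. 1" 1 x "f n"]
    by (simp add: diagonal_map_basis[OF f])
  then have "S (x - p) = T (x - p)" by (intro complement) (simp add: inner_diff_left)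
  moreover have "S p = T p"
    unfolding p_def diagonal_map_def mult_1
    by (simp add: S.suminf[OF sm] T.suminf[OF sm] S.scaleR T.scaleR basis)
  ultimately show "S x = T x" by (simp add: S.diff T.diff)
qed

section \<open>The weighted shift\<close>

text \<open>The recursion for \<open>w\<close> says that \<open>(w m)\<^sup>2\<close> is the sum of \<open>c\<close> over \<open>m\<close> and all its
  predecessors under \<open>\<sigma>\<close>. With \<open>\<sigma> n = n + 1\<close> the weights would be unbounded as soon as \<open>c\<close> is
  not summable. Since \<open>c\<close> tends to zero, \<open>\<sigma>\<close> can jump so far ahead that
  \<open>c (\<sigma> n) \<le> (1/2)^n\<close>; because \<open>n < \<sigma> n\<close>, the sum of \<open>c\<close> along an orbit, its first term
  apart, is then dominated by a geometric series.\<close>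

lemma shift_weights:
  fixes c :: "nat \<Rightarrow> real"
  assumes c0: "\<And>n. 0 \<le> c n" and lim: "c \<longlonglongrightarrow> 0"
  obtains \<sigma> :: "nat \<Rightarrow> nat" and w :: "nat \<Rightarrow> real" and M :: real
  where "inj \<sigma>" "\<And>n. 0 \<le> w n" "\<And>n. w n \<le> M"
    "\<And>n. (w (\<sigma> n))\<^sup>2 = c (\<sigma> n) + (w n)\<^sup>2" "\<And>m. m \<notin> range \<sigma> \<Longrightarrow> (w m)\<^sup>2 = c m"
proof -
  have far: "\<exists>s. k < s \<and> n < s \<and> c s \<le> (1/2)^n" for k n :: nat
  proof -
    have "eventually (\<lambda>s. c s < (1/2)^n) sequentially"
      using lim by (rule order_tendstoD) simp
    then have "eventually (\<lambda>s. k < s \<and> n < s \<and> c s < (1/2)^n) sequentially"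
      using eventually_gt_at_top[of k] eventually_gt_at_top[of n] by eventually_elim auto
    then obtain s where "k < s \<and> n < s \<and> c s < (1/2)^n"
      using eventually_happens'[OF sequentially_bot] by blast
    then show ?thesis by (auto intro: less_imp_le)
  qed
  have "\<exists>\<sigma>. \<forall>n. (n < \<sigma> n \<and> c (\<sigma> n) \<le> (1/2)^n) \<and> \<sigma> n < \<sigma> (Suc n)"
    by (rule dependent_nat_choice) (use far in blast)+
  then obtain \<sigma> where \<sigma>: "\<And>n. n < \<sigma> n" "\<And>n. c (\<sigma> n) \<le> (1/2)^n" "\<And>n. \<sigma> n < \<sigma> (Suc n)"
    by blast
  have inj: "inj \<sigma>"
    using \<sigma>(3) by (intro strict_mono_imp_inj_on) (simp add: strict_mono_Suc_iff)
  define anc where "anc m = {k. \<exists>j. (\<sigma> ^^ j) k = m}" for m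
  have ge: "k \<le> (\<sigma> ^^ j) k" for j k
    by (induction j) (auto intro: order_trans less_imp_le[OF \<sigma>(1)])
  then have anc_le: "anc m \<subseteq> {..m}" for m by (auto simp: anc_def)
  then have fin: "finite (anc m)" for m by (rule finite_subset) simp
  have anc_step: "anc (\<sigma> n) = insert (\<sigma> n) (anc n)" for n
  proof (intro equalityI subsetI)
    fix k assume "k \<in> anc (\<sigma> n)"
    then obtain j where "(\<sigma> ^^ j) k = \<sigma> n" by (auto simp: anc_def)
    then show "k \<in> insert (\<sigma> n) (anc n)"
      by (cases j) (auto simp: anc_def dest: injD[OF inj])
  next
    fix k assume "k \<in> insert (\<sigma> n) (anc n)"
    then consider "k = \<sigma> n" | j where "(\<sigma> ^^ j) k = n" by (auto simp: anc_def)
    then show "k \<in> anc (\<sigma> n)"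
    proof cases
      case 1
      then have "(\<sigma> ^^ 0) k = \<sigma> n" by simp
      then show ?thesis unfolding anc_def by blast
    next
      case 2
      then have "(\<sigma> ^^ Suc j) k = \<sigma> n" by simp
      then show ?thesis unfolding anc_def by blast
    qed
  qed
  have anc_root: "anc m = {m}" if "m \<notin> range \<sigma>" for m
  proof -
    have "k = m" if "(\<sigma> ^^ j) k = m" for k j
      using that \<open>m \<notin> range \<sigma>\<close> by (cases j) auto
    moreover have "m \<in> anc m" unfolding anc_def by (auto intro: exI[of _ 0])
    ultimately show ?thesis by (auto simp: anc_def)
  qed
  define W where "W m = sum c (anc m)" for m
  have W0: "0 \<le> W m" for m unfolding W_def using c0 by (intro sum_nonneg) auto
  have W_step: "W (\<sigma> n) = c (\<sigma> n) + W n" for n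
  proof -
    have "\<sigma> n \<notin> anc n" using anc_le[of n] \<sigma>(1)[of n] by auto
    then show ?thesis using fin by (simp add: W_def anc_step)
  qed
  have W_root: "W m = c m" if "m \<notin> range \<sigma>" for m
    using that by (simp add: W_def anc_root)
  obtain K where K: "\<And>n. c n \<le> K"
    using convergent_imp_Bseq[OF convergentI[OF lim]] by (auto simp: Bseq_def intro: abs_le_D1)
  \<comment> \<open>A uniform bound alone is not inductive; the subtracted term leaves room for the
    remaining tail of the geometric series.\<close>
  have W_le: "W m \<le> K + 2 - 2 * (1/2)^m" for m
  proof (induction m rule: less_induct)
    case (less m)
    show ?case
    proof (cases "m \<in> range \<sigma>")
      case True
      then obtain n where n: "m = \<sigma> n" by blast
      have "W m = c (\<sigma> n) + W n" using W_step n by simp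
      also have "\<dots> \<le> (1/2)^n + (K + 2 - 2 * (1/2)^n)"
        using \<sigma>(2)[of n] less[of n] \<sigma>(1)[of n] n by (intro add_mono) auto
      also have "(1/2::real)^m \<le> (1/2)^Suc n"
        using \<sigma>(1)[of n] n by (intro power_decreasing) auto
      then have "(1/2)^n + (K + 2 - 2 * (1/2)^n) \<le> K + 2 - 2 * (1/2)^m" by simp
      finally show ?thesis .
    next
      case False
      have "(1/2::real)^m \<le> 1" by (simp add: power_le_one)
      then show ?thesis using W_root[OF False] K[of m] by simp
    qed
  qed
  show thesis
  proof (rule that[OF inj, of "\<lambda>m. sqrt (W m)" "sqrt (K + 2)"])
    show "sqrt (W n) \<le> sqrt (K + 2)" for n
      using W_le[of n] zero_le_power[of "1/2::real" n] by (intro real_sqrt_le_mono) linarith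
  qed (use W0 c0 W_step W_root in auto)
qed

text \<open>For the weighted shift \<open>A\<close>, both \<open>A\<^sup>* A\<close> and \<open>A A\<^sup>*\<close> are diagonal along \<open>f\<close>: the entry of the
  first at \<open>m\<close> is \<open>(w m)\<^sup>2\<close>, and that of the second is the square of the weight leading into \<open>m\<close>, or
  zero if \<open>m\<close> is not in the range of \<open>\<sigma>\<close>. The recursion makes the difference \<open>c m\<close>.\<close>

lemma diagonal_self_commutator:
  fixes C :: "'a::{real_inner,complete_space} \<Rightarrow> 'a"
  assumes f: "orthonormal_sequence f" and lin: "bounded_linear C"
    and C_basis: "\<And>n. C (f n) = c n *\<^sub>R f n"
    and C_complement: "\<And>x. (\<And>n. x \<bullet> f n = 0) \<Longrightarrow> C x = 0"
    and inj: "inj \<sigma>" and w: "\<And>n. \<bar>w n\<bar> \<le> M"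
    and w_step: "\<And>n. (w (\<sigma> n))\<^sup>2 = c (\<sigma> n) + (w n)\<^sup>2"
    and w_root: "\<And>m. m \<notin> range \<sigma> \<Longrightarrow> (w m)\<^sup>2 = c m"
  defines "A \<equiv> diagonal_map w f (f \<circ> \<sigma>)"
  shows "bounded_linear A" "C = (\<lambda>x. adjoint A (A x) - A (adjoint A x))"
proof -
  have f\<sigma>: "orthonormal_sequence (f \<circ> \<sigma>)"
    using f inj by (auto simp: orthonormal_sequence_def inj_eq)
  define B where "B = diagonal_map w (f \<circ> \<sigma>) f"
  have adj: "adjoint A = B"
    unfolding A_def B_def by (intro adjoint_unique allI diagonal_map_adjoint[OF f f\<sigma> w])
  show A: "bounded_linear A"
    unfolding A_def by (rule bounded_linear_diagonal_map[OF f f\<sigma> w])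
  have B: "bounded_linear B"
    unfolding B_def by (rule bounded_linear_diagonal_map[OF f\<sigma> f w])
  interpret A: bounded_linear A by fact
  interpret B: bounded_linear B by fact
  have A_f: "A (f n) = w n *\<^sub>R f (\<sigma> n)" for n
    by (simp add: A_def diagonal_map_basis[OF f])
  have B_f: "B (f (\<sigma> n)) = w n *\<^sub>R f n" for n
    using diagonal_map_basis[OF f\<sigma>, of w f n] by (simp add: B_def)
  have B_root: "B (f m) = 0" if "m \<notin> range \<sigma>" for m
    unfolding B_def using that f by (intro diagonal_map_complement) (auto simp: orthonormal_sequence_def)
  have "C = (\<lambda>x. B (A x) - A (B x))"
  proof (rule bounded_linear_eqI_orthonormal[OF f lin])
    show "bounded_linear (\<lambda>x. B (A x) - A (B x))"
      by (intro bounded_linear_sub bounded_linear_compose[OF A B] bounded_linear_compose[OF B A])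
    show "C (f m) = B (A (f m)) - A (B (f m))" for m
    proof (cases "m \<in> range \<sigma>")
      case True
      then obtain n where m: "m = \<sigma> n" by blast
      show ?thesis
        using w_step[of n]
        by (simp add: m C_basis A_f B_f A.scaleR B.scaleR power2_eq_square flip: scaleR_left_diff_distrib)
    next
      case False
      then show ?thesis
        using w_root[OF False]
        by (simp add: C_basis A_f B_f B_root A.zero B.scaleR power2_eq_square)
    qed
    show "C x = B (A x) - A (B x)" if "\<And>n. x \<bullet> f n = 0" for x
    proof -
      have "A x = 0" "B x = 0"
        unfolding A_def B_def using that by (auto intro!: diagonal_map_complement simp: inner_commute)
      then show ?thesis using C_complement[OF that] by (simp add: A.zero B.zero)
    qed
  qed
  then show "C = (\<lambda>x. adjoint A (A x) - A (adjoint A x))" by (simp add: adj)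
qed

text \<open>Positivity is tested against the self-dual cone, where the inner product is a series of
  nonnegative terms.\<close>

lemma positive_diagonal_map:
  fixes f g :: "nat \<Rightarrow> 'a::hilbert_lattice"
  assumes "orthonormal_sequence f" "orthonormal_sequence g"
    and "\<And>n. 0 \<le> w n" "\<And>n. w n \<le> M" and "\<And>n. 0 \<le> f n" "\<And>n. 0 \<le> g n"
  shows "positive_operator (diagonal_map w f g)"
  unfolding positive_operator_def
proof (intro allI impI)
  fix x :: 'a assume x: "0 \<le> x"
  have w: "\<bar>w n\<bar> \<le> M" for n using assms(3,4) by simp
  show "0 \<le> diagonal_map w f g x"
  proof (rule nonneg_if_inner_nonneg)
    fix y :: 'a assume y: "0 \<le> y"
    have "summable (\<lambda>n. ((w n * (f n \<bullet> x)) *\<^sub>R g n) \<bullet> y)"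
      by (intro bounded_linear.summable[OF bounded_linear_inner_left]
          diagonal_map_summable[OF assms(1,2) w])
    then show "0 \<le> diagonal_map w f g x \<bullet> y"
      unfolding inner_diagonal_map[OF assms(1,2) w]
      using x y assms by (intro suminf_nonneg) (auto intro!: mult_nonneg_nonneg inner_nonneg)
  qed
qed

theorem theorem4p1:
  fixes C :: "'a::hilbert_lattice \<Rightarrow> 'a"
  assumes separable: "separable_space (euclidean :: 'a topology)"
    and infinite_dim: "\<nexists>B :: 'a set. finite B \<and> span B = UNIV"
    and linear: "bounded_linear C"
    and positive: "positive_operator C"
    and compact: "compact_operator C"
    and central: "central_operator C"
  shows "\<exists>A :: 'a \<Rightarrow> 'a. bounded_linear A \<and> positive_operator A \<and>
           C = (\<lambda>x. adjoint A (A x) - A (adjoint A x))"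
proof -
  obtain f :: "nat \<Rightarrow> 'a" and c where f: "orthonormal_sequence f" "\<And>n. 0 \<le> f n"
    and C: "\<And>n. C (f n) = c n *\<^sub>R f n" "\<And>x. (\<And>n. x \<bullet> f n = 0) \<Longrightarrow> C x = 0"
    and c: "\<And>n. 0 \<le> c n" "c \<longlonglongrightarrow> 0"
    using positive_diagonalisation[OF infinite_dim linear positive compact central] by metis
  obtain \<sigma> w M where \<sigma>: "inj \<sigma>" and w: "\<And>n. 0 \<le> w n" "\<And>n. w n \<le> M"
    and rec: "\<And>n. (w (\<sigma> n))\<^sup>2 = c (\<sigma> n) + (w n)\<^sup>2" "\<And>m. m \<notin> range \<sigma> \<Longrightarrow> (w m)\<^sup>2 = c m"
    using shift_weights[OF c] by metis
  have w_abs: "\<bar>w n\<bar> \<le> M" for n using w by simp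
  have "orthonormal_sequence (f \<circ> \<sigma>)"
    using f(1) \<sigma> by (auto simp: orthonormal_sequence_def inj_eq)
  then have "positive_operator (diagonal_map w f (f \<circ> \<sigma>))"
    using f w by (intro positive_diagonal_map) auto
  then show ?thesis
    using diagonal_self_commutator[OF f(1) linear C \<sigma> w_abs rec] by blast
qed

end
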